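(* Let $\{p(x,y)\}_{x,y\in V}$ be the transition probabilities of an irreducible Markov chain on a countable state space $V$ with stationary distribution $\pi$. Let $x\in V$, $\epsilon>0$, and denote $\mu_n=p^n(x,\cdot)$. Then $\chi^2(\mu_n,\pi)\le\epsilon$ for all integers $n\ge0$ with $$n\ge\int_{4\pi(x)}^{4/\epsilon}\frac{du}{u\,\psi(u)}.$$
   Context: Here $\pi$ is a probability distribution with $\sum_{x\in V}\pi(x)p(x,y)=\pi(y)$ for all $y$, and $p^n(x,\cdot)$ is the $n$-step transition distribution from $x$. For a probability measure $\mu$ on $V$, $$\chi^2(\mu,\pi)=\sum_{y\in V}\pi(y)\Big(\frac{\mu(y)}{\pi(y)}-1\Big)^2=\Big(\sum_{y\in V}\frac{\mu(y)^2}{\pi(y)}\Big)-1.$$ Let $Q(x,y)=\pi(x)p(x,y)$, and $Q(S,y)=\sum_{s\in S}Q(s,y)$ for $S\subset V$. For $S\subset V$ let $\widetilde S=\{y\in V:\ Q(S,y)\ge U\pi(y)\}$, where $U$ is uniform on $[0,1]$, and let $\mathbf{E}_S$ denote expectation over $U$. For nonempty $S\subset V$ put $$\psi(S)=1-\mathbf{E}_S\sqrt{\frac{\pi(\widetilde S)}{\pi(S)}}.$$ The root profile is $\psi(r)=\inf\{\psi(S):\ \emptyset\ne S\subset V,\ \pi(S)\le r\}$ for $0<r\le 1/2$, and $\psi(r)=\psi(1/2)$ for $r>1/2$ (with $\inf\emptyset=+\infty$, $1/\infty=0$, $1/0=+\infty$). *)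

theory Defs
  imports "HOL-Probability.Probability"
begin

text \<open>The state space is the whole countable type; \<open>p x\<close> is the law of the next state
  from \<open>x\<close>, so \<open>p(x,y)\<close> is \<open>pmf (p x) y\<close>.\<close>

primrec nstep :: "('a \<Rightarrow> 'a pmf) \<Rightarrow> nat \<Rightarrow> 'a \<Rightarrow> 'a pmf" where
  "nstep p 0 x = return_pmf x"
| "nstep p (Suc n) x = bind_pmf (nstep p n x) p"

definition irreducible_chain :: "('a \<Rightarrow> 'a pmf) \<Rightarrow> bool" where
  "irreducible_chain p \<longleftrightarrow> (\<forall>x y. \<exists>n. pmf (nstep p n x) y > 0)"

definition stationary :: "('a \<Rightarrow> 'a pmf) \<Rightarrow> 'a pmf \<Rightarrow> bool" where
  "stationary p \<pi> \<longleftrightarrow> (\<forall>y. ((\<lambda>x. pmf \<pi> x * pmf (p x) y) has_sum pmf \<pi> y) UNIV)"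

text \<open>Valued in \<^typ>\<open>ennreal\<close> because the series may diverge for a general \<open>\<mu>\<close>.\<close>

definition chi_square :: "'a pmf \<Rightarrow> 'a pmf \<Rightarrow> ennreal" where
  "chi_square \<mu> \<pi> =
     (\<integral>\<^sup>+ y. ennreal (pmf \<pi> y * (pmf \<mu> y / pmf \<pi> y - 1)\<^sup>2) \<partial>count_space UNIV)"

definition Q :: "('a \<Rightarrow> 'a pmf) \<Rightarrow> 'a pmf \<Rightarrow> 'a \<Rightarrow> 'a \<Rightarrow> real" where
  "Q p \<pi> x y = pmf \<pi> x * pmf (p x) y"

definition Q_set :: "('a \<Rightarrow> 'a pmf) \<Rightarrow> 'a pmf \<Rightarrow> 'a set \<Rightarrow> 'a \<Rightarrow> real" where
  "Q_set p \<pi> S y = (\<Sum>\<^sub>\<infinity>s\<in>S. Q p \<pi> s y)"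

text \<open>The set \<open>S~\<close> for the value \<open>u\<close> of the uniform variable.\<close>

definition evolve :: "('a \<Rightarrow> 'a pmf) \<Rightarrow> 'a pmf \<Rightarrow> 'a set \<Rightarrow> real \<Rightarrow> 'a set" where
  "evolve p \<pi> S u = {y. Q_set p \<pi> S y \<ge> u * pmf \<pi> y}"

definition psi_set :: "('a \<Rightarrow> 'a pmf) \<Rightarrow> 'a pmf \<Rightarrow> 'a set \<Rightarrow> real" where
  "psi_set p \<pi> S = 1 - (\<integral>u. sqrt (measure_pmf.prob \<pi> (evolve p \<pi> S u) / measure_pmf.prob \<pi> S)
                           \<partial>uniform_measure lborel {0..1})"

text \<open>In \<^typ>\<open>ereal\<close> the infimum of the empty set is \<open>\<infinity>\<close>. The \<open>min\<close> makes the
  profile constant for \<open>r > 1/2\<close>. By Jensen, \<open>psi_set\<close> of a nonempty set is nonnegative under stationarity.\<close>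

definition root_profile :: "('a \<Rightarrow> 'a pmf) \<Rightarrow> 'a pmf \<Rightarrow> real \<Rightarrow> ereal" where
  "root_profile p \<pi> r =
     (INF S \<in> {S. S \<noteq> {} \<and> measure_pmf.prob \<pi> S \<le> min r (1/2)}. ereal (psi_set p \<pi> S))"

text \<open>Oriented integral of a nonnegative extended-real function, possibly infinite; as usual, it
  changes sign when the endpoints are exchanged.\<close>

definition ext_integral :: "real \<Rightarrow> real \<Rightarrow> (real \<Rightarrow> ereal) \<Rightarrow> ereal" where
  "ext_integral a b f =
     (if a \<le> b then enn2ereal (\<integral>\<^sup>+ u \<in> {a..b}. e2ennreal (f u) \<partial>lborel)
      else - enn2ereal (\<integral>\<^sup>+ u \<in> {b..a}. e2ennreal (f u) \<partial>lborel))"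

end

theory Submission
  imports Defs
begin

text \<open>
  The proof follows the set-valued process of evolving sets \<open>S\<^sub>0 = {x}, S\<^sub>1, S\<^sub>2, \<dots>\<close>,
  in which each set is replaced by its random evolution with a fresh uniform threshold.

  A point \<open>y\<close> enters the evolution of \<open>S\<close> with probability \<open>Q(S,y)/\<pi>(y)\<close>, which is linear
  in the indicator of \<open>S\<close>. Hence averages over the set process are governed by the
  chain itself, \<open>\<pi>(y) P(y \<in> S\<^sub>n) = \<pi>(x) p\<^sup>n(x,y)\<close>
  (\<open>evolving_law_duality\<close>), and \<open>\<pi>(S\<^sub>n)\<close> has constant mean \<open>\<pi>(x)\<close>.
  The density of \<open>p\<^sup>n(x,\<cdot>)\<close> minus one is therefore an average of the centred indicators
  \<open>1\<^bsub>S\<^esub> - \<pi>(S)\<close>, divided by \<open>\<pi>(x)\<close>. The norm of a centred indicator in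
  \<open>L\<^sup>2(\<pi>)\<close> is at most \<open>sqrt (min (\<pi>(S)) (1 - \<pi>(S)))\<close>, the \<open>root_gauge\<close> of \<open>S\<close>.
  By Minkowski's inequality, proved through duality, the chi-square distance is at most the
  square of \<open>L\<^sub>n = E (root_gauge S\<^sub>n) / \<pi>(x)\<close> (\<open>chi_square_le_mean_gauge\<close>).

  One step of evolution multiplies the expected gauge of \<open>S\<close> by at most \<open>1 - \<psi>\<close>, where \<open>\<psi>\<close>
  is evaluated at \<open>S\<close> or at its complement, whichever is smaller: complements evolve like
  evolving sets, with the threshold reflected in \<open>[0,1]\<close>. Sets whose gauge is large relative to
  their mass are small, so the profile bounds their \<open>\<psi>\<close> from below; the sets
  whose gauge is at most \<open>L\<^sub>n/2\<close> times their mass contribute at most half of the mean. This yields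
  \<open>L\<^bsub>n+1\<^esub> \<le> L\<^sub>n (1 - \<psi>(4/L\<^sub>n\<^sup>2)/2)\<close> (\<open>mean_gauge_Suc\<close>).

  In terms of \<open>a\<^sub>n = 4/L\<^sub>n\<^sup>2\<close> the recursion reads \<open>ln (a\<^bsub>n+1\<^esub>/a\<^sub>n) \<ge> \<psi>(a\<^sub>n)\<close>. Since \<open>\<psi>\<close>
  decreases, every step uses up at least one unit of the integral of \<open>1/(u \<psi>(u))\<close>
  (\<open>lt_nn_integral_inverse_profile\<close>). The integral
  starts at \<open>4 \<pi>(x) \<le> a\<^sub>0\<close>, so as many steps as its value up to \<open>4/\<epsilon>\<close> push \<open>a\<^sub>n\<close> to
  \<open>4/\<epsilon>\<close>, that is, \<open>L\<^sub>n\<^sup>2\<close> down to \<open>\<epsilon>\<close>.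
\<close>

section \<open>Random sets and uniform thresholds\<close>

text \<open>The coordinate \<open>\<sigma>\<close>-algebra on the power set. The power set is uncountable and its discrete
  \<open>\<sigma>\<close>-algebra too fine for the random evolution; here, measurability into the space can be
  checked for one point at a time.\<close>
definition subset_space :: "'a set measure" where
  "subset_space = sigma UNIV (range (\<lambda>y. {S. y \<in> S}))"

lemma space_subset_space [simp]: "space subset_space = UNIV"
  by (simp add: subset_space_def space_measure_of_conv)

lemma measurable_into_subset_space:
  assumes "\<And>y. Measurable.pred M (\<lambda>\<omega>. y \<in> f \<omega>)"
  shows "f \<in> measurable M subset_space"
  unfolding subset_space_def
proof (rule measurable_sigma_sets[OF sets_measure_of])
  fix A :: "'a set set" assume "A \<in> range (\<lambda>y. {S. y \<in> S})"
  then obtain y where "A = {S. y \<in> S}" by auto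
  then have "f -` A \<inter> space M = {\<omega> \<in> space M. y \<in> f \<omega>}" by auto
  then show "f -` A \<inter> space M \<in> sets M" using assms[of y] by (simp add: pred_def)
qed auto

lemma pred_mem_subset_space [measurable]: "Measurable.pred subset_space (\<lambda>S. y \<in> S)"
proof -
  have "{S. y \<in> S} \<in> sets subset_space"
    unfolding subset_space_def by (auto simp: sets_measure_of_conv)
  then show ?thesis by (simp add: pred_def)
qed

text \<open>Joint measurability in the set and the point needs a countable point space: then the
  point can be held fixed.\<close>
lemma measurable_indicator_pair [measurable]:
  "(\<lambda>(S, s). indicator S s :: real) \<in> borel_measurable (subset_space \<Otimes>\<^sub>M measure_pmf (q :: 'a::countable pmf))"
proof -
  have "(\<lambda>z. indicator (fst z) (snd z) :: real) \<in> borel_measurable (subset_space \<Otimes>\<^sub>M measure_pmf q)"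
  proof (rule measurable_compose_countable[where f = "\<lambda>s z. indicator (fst z) s :: real" and g = snd])
    fix s :: 'a
    have "(\<lambda>S. indicator S s :: real) \<in> borel_measurable subset_space" by measurable
    then show "(\<lambda>z. indicator (fst z) s :: real) \<in> borel_measurable (subset_space \<Otimes>\<^sub>M measure_pmf q)"
      by (rule measurable_compose[OF measurable_fst])
  qed (simp add: measurable_cong_sets[OF refl sets_measure_pmf_count_space, symmetric])
  then show ?thesis by (simp add: case_prod_beta')
qed

abbreviation unif :: "real measure" where
  "unif \<equiv> uniform_measure lborel {0..1}"

interpretation unif: prob_space unif
  by (rule prob_space_uniform_measure) auto

lemma emeasure_unif_atMost:
  assumes "0 \<le> c" "c \<le> 1"
  shows "emeasure unif {u. u \<le> c} = ennreal c"
proof -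
  have "{0..1} \<inter> {u. u \<le> c} = {0..c}" using assms by auto
  then show ?thesis using assms by (subst emeasure_uniform_measure) (auto simp: divide_ennreal simp flip: ennreal_1)
qed

section \<open>Stationary chains\<close>

lemma stationary_has_sum: "stationary p \<pi> \<Longrightarrow> ((\<lambda>s. Q p \<pi> s y) has_sum pmf \<pi> y) UNIV"
  by (simp add: stationary_def Q_def)

text \<open>\<^const>\<open>Q_set\<close> is an unordered sum, whereas the probabilistic arguments use Bochner
  integrals. Absolute summability is what lets the two be exchanged.\<close>
lemma stationary_abs_summable:
  assumes "stationary p \<pi>"
  shows "Infinite_Set_Sum.abs_summable_on (\<lambda>s. Q p \<pi> s y) S"
proof -
  have "(\<lambda>s. Q p \<pi> s y) summable_on S"
    by (rule summable_on_subset_banach[of _ UNIV])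
       (use stationary_has_sum[OF assms] in \<open>auto simp: summable_on_def\<close>)
  then have "(\<lambda>s. norm (Q p \<pi> s y)) summable_on S" by (simp add: Q_def)
  then show ?thesis using abs_summable_equivalent by blast
qed

lemma bind_pmf_stationary:
  assumes "stationary p \<pi>"
  shows "bind_pmf \<pi> p = \<pi>"
proof (rule pmf_eqI)
  fix y
  show "pmf (bind_pmf \<pi> p) y = pmf \<pi> y"
    using infsetsum_infsum[OF stationary_abs_summable[OF assms, of y UNIV]]
      infsumI[OF stationary_has_sum[OF assms, of y]]
    by (simp add: pmf_bind pmf_expectation_eq_infsetsum Q_def)
qed

text \<open>Irreducibility speaks of \<open>n\<close>-step transitions, so invariance is needed for these to
  spread the positivity of \<open>\<pi>\<close> from one state to all.\<close>
lemma nstep_stationary: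
  assumes "bind_pmf \<pi> p = \<pi>"
  shows "bind_pmf \<pi> (nstep p n) = \<pi>"
proof (induction n)
  case 0
  then show ?case by (simp add: bind_return_pmf')
next
  case (Suc n)
  have "bind_pmf \<pi> (nstep p (Suc n)) = bind_pmf \<pi> (\<lambda>x. bind_pmf (nstep p n x) p)"
    by (rule arg_cong[where f = "bind_pmf \<pi>"]) (simp add: fun_eq_iff)
  also have "\<dots> = bind_pmf (bind_pmf \<pi> (nstep p n)) p"
    by (rule bind_assoc_pmf[symmetric])
  finally show ?case by (simp only: Suc assms)
qed

text \<open>Positivity of the stationary law is what irreducibility contributes: it turns membership
  in an evolved set into a threshold for the uniform variable.\<close>
locale stationary_chain =
  fixes p :: "'a::countable \<Rightarrow> 'a pmf" and \<pi> :: "'a pmf"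
  assumes stationary: "stationary p \<pi>"
    and pmf_pos: "\<And>y. pmf \<pi> y > 0"

lemma irreducible_stationary_chain:
  fixes p :: "'a::countable \<Rightarrow> 'a pmf"
  assumes "irreducible_chain p" "stationary p \<pi>"
  shows "stationary_chain p \<pi>"
proof
  fix y
  obtain s where "s \<in> set_pmf \<pi>" using set_pmf_not_empty[of \<pi>] by blast
  obtain n where "pmf (nstep p n s) y > 0" using assms(1) by (auto simp: irreducible_chain_def)
  then have "y \<in> set_pmf (nstep p n s)" by (simp add: set_pmf_iff)
  then have "y \<in> set_pmf (bind_pmf \<pi> (nstep p n))"
    using \<open>s \<in> set_pmf \<pi>\<close> by auto
  then show "pmf \<pi> y > 0"
    by (simp add: nstep_stationary[OF bind_pmf_stationary[OF assms(2)]] pmf_positive)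
qed (rule assms)

section \<open>One step of the evolution of sets\<close>

context stationary_chain
begin

abbreviation mass :: "'a set \<Rightarrow> real" where
  "mass S \<equiv> measure_pmf.prob \<pi> S"

lemma Q_set_eq_integral: "Q_set p \<pi> S y = (\<integral>s. indicator S s * pmf (p s) y \<partial>\<pi>)"
proof -
  have "Q_set p \<pi> S y = infsetsum (\<lambda>s. Q p \<pi> s y) S"
    unfolding Q_set_def by (rule infsetsum_infsum[OF stationary_abs_summable[OF stationary], symmetric])
  also have "\<dots> = infsetsum (\<lambda>s. pmf \<pi> s * (indicator S s * pmf (p s) y)) UNIV"
    by (intro infsetsum_cong_neutral) (auto simp: Q_def)
  finally show ?thesis by (simp add: pmf_expectation_eq_infsetsum)
qed

lemma ennreal_Q_set: "ennreal (Q_set p \<pi> S y) = (\<integral>\<^sup>+s. ennreal (indicator S s * pmf (p s) y) \<partial>\<pi>)"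
  unfolding Q_set_eq_integral
  by (rule nn_integral_eq_integral[symmetric])
     (auto intro!: measure_pmf.integrable_const_bound[where B=1] simp: indicator_def pmf_le_1)

lemma Q_set_nonneg [simp]: "Q_set p \<pi> S y \<ge> 0"
  unfolding Q_set_eq_integral by (intro integral_nonneg_AE) auto

lemma Q_set_UNIV: "Q_set p \<pi> UNIV y = pmf \<pi> y"
  unfolding Q_set_def using stationary_has_sum[OF stationary] infsumI by blast

text \<open>Stationarity: the flows into \<open>y\<close> from a set and from its complement add up to
  \<open>\<pi>(y)\<close>. This makes \<open>Q(S,y)/\<pi>(y)\<close> a probability and gives complements an evolution of the
  same kind.\<close>
lemma Q_set_Compl: "Q_set p \<pi> S y + Q_set p \<pi> (- S) y = pmf \<pi> y"
proof -
  have "pmf \<pi> y = (\<integral>s. indicator S s * pmf (p s) y + indicator (- S) s * pmf (p s) y \<partial>\<pi>)"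
    unfolding Q_set_UNIV[symmetric] Q_set_eq_integral
    by (intro Bochner_Integration.integral_cong) (auto simp: indicator_def)
  also have "\<dots> = Q_set p \<pi> S y + Q_set p \<pi> (- S) y"
    unfolding Q_set_eq_integral
    by (intro Bochner_Integration.integral_add measure_pmf.integrable_const_bound[where B=1])
       (auto simp: indicator_def pmf_le_1)
  finally show ?thesis by simp
qed

lemma Q_set_le: "Q_set p \<pi> S y \<le> pmf \<pi> y"
  using Q_set_Compl[of S y] Q_set_nonneg[of "- S" y] by linarith

lemma mem_evolve_iff: "y \<in> evolve p \<pi> S u \<longleftrightarrow> u \<le> Q_set p \<pi> S y / pmf \<pi> y"
  using pmf_pos[of y] by (simp add: evolve_def field_simps)

lemma prob_mem_evolve:
  "(\<integral>\<^sup>+u. indicator (evolve p \<pi> S u) y \<partial>unif) = ennreal (Q_set p \<pi> S y / pmf \<pi> y)"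
proof -
  have "(\<integral>\<^sup>+u. indicator (evolve p \<pi> S u) y \<partial>unif)
      = (\<integral>\<^sup>+u. indicator {u. u \<le> Q_set p \<pi> S y / pmf \<pi> y} u \<partial>unif)"
    by (intro nn_integral_cong) (auto simp: indicator_def mem_evolve_iff)
  also have "\<dots> = ennreal (Q_set p \<pi> S y / pmf \<pi> y)"
    using Q_set_le[of S y] pmf_pos[of y]
    by (simp add: nn_integral_indicator emeasure_unif_atMost del: emeasure_uniform_measure)
  finally show ?thesis .
qed

lemma measurable_Q_set [measurable]: "(\<lambda>S. Q_set p \<pi> S y) \<in> borel_measurable subset_space"
proof -
  have "(\<lambda>S. \<integral>s. indicator S s * pmf (p s) y \<partial>\<pi>) \<in> borel_measurable subset_space"
  proof (rule measure_pmf.borel_measurable_lebesgue_integral)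
    show "(\<lambda>(S, s). indicator S s * pmf (p s) y) \<in> borel_measurable (subset_space \<Otimes>\<^sub>M measure_pmf \<pi>)"
      using measurable_indicator_pair by measurable
  qed
  then show ?thesis by (simp add: Q_set_eq_integral)
qed

lemma measurable_evolve2 [measurable]:
  "(\<lambda>(S, u). evolve p \<pi> S u) \<in> subset_space \<Otimes>\<^sub>M unif \<rightarrow>\<^sub>M subset_space"
proof (rule measurable_into_subset_space)
  fix y
  show "Measurable.pred (subset_space \<Otimes>\<^sub>M unif) (\<lambda>\<omega>. y \<in> (case \<omega> of (S, u) \<Rightarrow> evolve p \<pi> S u))"
    unfolding case_prod_beta mem_evolve_iff by measurable
qed

lemma measurable_evolve [measurable]: "evolve p \<pi> S \<in> unif \<rightarrow>\<^sub>M subset_space"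
  using measurable_compose[OF _ measurable_evolve2, of "\<lambda>u. (S,u)" unif] by simp

lemma measurable_mass [measurable]: "mass \<in> borel_measurable subset_space"
proof -
  have "(\<lambda>S. \<integral>s. (indicator S s :: real) \<partial>\<pi>) \<in> borel_measurable (subset_space :: 'a set measure)"
  proof (rule measure_pmf.borel_measurable_lebesgue_integral)
    show "(\<lambda>(S, s). indicator S s :: real) \<in> borel_measurable (subset_space \<Otimes>\<^sub>M measure_pmf \<pi>)"
      using measurable_indicator_pair by measurable
  qed
  then show ?thesis by simp
qed

text \<open>Evolution preserves mass on average, because \<open>y\<close> enters with probability \<open>Q(S,y)/\<pi>(y)\<close>
  and the total flow out of \<open>S\<close> is \<open>\<pi>(S)\<close>.\<close>
lemma nn_integral_mass_evolve:
  "(\<integral>\<^sup>+u. ennreal (mass (evolve p \<pi> S u)) \<partial>unif) = ennreal (mass S)"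
proof -
  have mem: "Measurable.pred unif (\<lambda>u. y \<in> evolve p \<pi> S u)" for y
    by measurable
  have "(\<integral>\<^sup>+u. ennreal (mass (evolve p \<pi> S u)) \<partial>unif)
      = (\<integral>\<^sup>+u. \<integral>\<^sup>+y. ennreal (pmf \<pi> y) * indicator (evolve p \<pi> S u) y \<partial>count_space UNIV \<partial>unif)"
    by (simp add: measure_pmf.emeasure_eq_measure[symmetric] nn_integral_measure_pmf[symmetric])
  also have "\<dots> = (\<integral>\<^sup>+y. ennreal (pmf \<pi> y) * (\<integral>\<^sup>+u. indicator (evolve p \<pi> S u) y \<partial>unif) \<partial>count_space UNIV)"
    using mem by (subst nn_integral_count_space_nn_integral) (auto simp: nn_integral_cmult)
  also have "\<dots> = (\<integral>\<^sup>+y. ennreal (Q_set p \<pi> S y) \<partial>count_space UNIV)"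
    using pmf_pos by (intro nn_integral_cong)
      (simp add: prob_mem_evolve ennreal_mult''[symmetric] less_imp_neq[symmetric])
  also have "\<dots> = (\<integral>\<^sup>+s. \<integral>\<^sup>+y. ennreal (indicator S s * pmf (p s) y) \<partial>count_space UNIV \<partial>\<pi>)"
    unfolding ennreal_Q_set by (rule nn_integral_count_space_nn_integral[symmetric]) auto
  also have "\<dots> = (\<integral>\<^sup>+s. indicator S s \<partial>\<pi>)"
    by (intro nn_integral_cong) (auto simp: indicator_def nn_integral_pmf)
  finally show ?thesis by (simp add: measure_pmf.emeasure_eq_measure)
qed

section \<open>The evolving set process and its duality with the chain\<close>

definition evolution_kernel :: "'a set \<Rightarrow> 'a set measure" where
  "evolution_kernel S = distr unif subset_space (evolve p \<pi> S)"

primrec evolving_law :: "nat \<Rightarrow> 'a \<Rightarrow> 'a set measure" where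
  "evolving_law 0 x = return subset_space {x}"
| "evolving_law (Suc n) x = bind (evolving_law n x) evolution_kernel"

lemma measurable_kernel [measurable]:
  "evolution_kernel \<in> subset_space \<rightarrow>\<^sub>M prob_algebra subset_space"
  unfolding evolution_kernel_def
  by (rule measurable_prob_algebraI)
     (auto intro!: unif.prob_space_distr measurable_distr2[where M=unif] measurable_const
           simp: space_subprob_algebra unif.subprob_space_axioms)

lemma evolving_law_in_prob_algebra: "evolving_law n x \<in> space (prob_algebra subset_space)"
  by (induction n) (auto simp: space_prob_algebra prob_space_return
      intro!: prob_space_bind'[of _ subset_space] sets_bind'[of _ subset_space] measurable_kernel)

lemma sets_evolving_law [measurable_cong, simp]: "sets (evolving_law n x) = sets subset_space"
  using evolving_law_in_prob_algebra[of n x] by (simp add: space_prob_algebra)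

lemma prob_space_evolving_law: "prob_space (evolving_law n x)"
  using evolving_law_in_prob_algebra[of n x] by (simp add: space_prob_algebra)

lemma nn_integral_evolving_law_Suc:
  assumes [measurable]: "f \<in> borel_measurable subset_space"
  shows "(\<integral>\<^sup>+S. f S \<partial>evolving_law (Suc n) x)
       = (\<integral>\<^sup>+S. \<integral>\<^sup>+u. f (evolve p \<pi> S u) \<partial>unif \<partial>evolving_law n x)"
proof -
  have "evolution_kernel \<in> evolving_law n x \<rightarrow>\<^sub>M subprob_algebra subset_space"
    using measurable_prob_algebraD[OF measurable_kernel]
    by (simp add: measurable_cong_sets[OF sets_evolving_law refl])
  then have "(\<integral>\<^sup>+S. f S \<partial>evolving_law (Suc n) x)
       = (\<integral>\<^sup>+S. \<integral>\<^sup>+T. f T \<partial>evolution_kernel S \<partial>evolving_law n x)"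
    by (simp add: nn_integral_bind[OF assms])
  also have "\<dots> = (\<integral>\<^sup>+S. \<integral>\<^sup>+u. f (evolve p \<pi> S u) \<partial>unif \<partial>evolving_law n x)"
    unfolding evolution_kernel_def by (simp add: nn_integral_distr)
  finally show ?thesis .
qed

lemma nn_integral_mass_evolving_law:
  "(\<integral>\<^sup>+S. ennreal (mass S) \<partial>evolving_law n x) = ennreal (pmf \<pi> x)"
proof (induction n)
  case 0
  then show ?case by (simp add: nn_integral_return measure_pmf_single)
next
  case (Suc n)
  then show ?case
    by (subst nn_integral_evolving_law_Suc) (simp_all add: nn_integral_mass_evolve)
qed

text \<open>The bridge from sets to the chain. The entrance probability \<open>Q(S,y)/\<pi>(y)\<close> is additive
  over the points of \<open>S\<close>, so the membership probabilities of the set process satisfy a closed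
  linear recursion, which is the one for the \<open>n\<close>-step transition probabilities.\<close>
lemma evolving_law_duality:
  "ennreal (pmf \<pi> y) * (\<integral>\<^sup>+S. indicator S y \<partial>evolving_law n x)
     = ennreal (pmf \<pi> x * pmf (nstep p n x) y)"
proof (induction n arbitrary: y)
  case 0
  have "(\<lambda>S. indicator S y :: ennreal) \<in> borel_measurable subset_space" by measurable
  then show ?case by (simp add: nn_integral_return indicator_def)
next
  case (Suc n)
  have m: "(\<lambda>S. indicator S z :: ennreal) \<in> borel_measurable subset_space" for z by measurable
  have "ennreal (pmf \<pi> y) * (\<integral>\<^sup>+S. indicator S y \<partial>evolving_law (Suc n) x)
      = ennreal (pmf \<pi> y) * (\<integral>\<^sup>+S. ennreal (Q_set p \<pi> S y / pmf \<pi> y) \<partial>evolving_law n x)"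
    by (subst nn_integral_evolving_law_Suc[OF m]) (simp add: prob_mem_evolve)
  also have "\<dots> = (\<integral>\<^sup>+S. ennreal (Q_set p \<pi> S y) \<partial>evolving_law n x)"
    using pmf_pos[of y] by (subst nn_integral_cmult[symmetric])
      (auto simp: ennreal_mult''[symmetric] intro!: nn_integral_cong)
  also have "\<dots> = (\<integral>\<^sup>+S. \<integral>\<^sup>+s. ennreal (pmf \<pi> s) * (ennreal (pmf (p s) y) * indicator S s)
                      \<partial>count_space UNIV \<partial>evolving_law n x)"
    unfolding ennreal_Q_set nn_integral_measure_pmf
    by (intro nn_integral_cong) (auto simp: indicator_def)
  also have "\<dots> = (\<integral>\<^sup>+s. \<integral>\<^sup>+S. ennreal (pmf \<pi> s) * (ennreal (pmf (p s) y) * indicator S s)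
                      \<partial>evolving_law n x \<partial>count_space UNIV)"
    by (rule nn_integral_count_space_nn_integral) (auto intro!: borel_measurable_times_ennreal simp: measurable_cong_sets[OF sets_evolving_law refl] m)
  also have "\<dots> = (\<integral>\<^sup>+s. ennreal (pmf (p s) y) * (ennreal (pmf \<pi> s) * (\<integral>\<^sup>+S. indicator S s \<partial>evolving_law n x))
                      \<partial>count_space UNIV)"
    using m by (intro nn_integral_cong)
      (simp add: nn_integral_cmult measurable_cong_sets[OF sets_evolving_law refl] mult.left_commute)
  also have "\<dots> = (\<integral>\<^sup>+s. ennreal (pmf \<pi> x) * (ennreal (pmf (nstep p n x) s) * ennreal (pmf (p s) y)) \<partial>count_space UNIV)"
    unfolding Suc.IH by (intro nn_integral_cong) (simp add: ennreal_mult ac_simps)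
  also have "\<dots> = ennreal (pmf \<pi> x) * (\<integral>\<^sup>+s. ennreal (pmf (p s) y) \<partial>nstep p n x)"
    by (simp add: nn_integral_cmult nn_integral_measure_pmf)
  also have "\<dots> = ennreal (pmf \<pi> x * pmf (nstep p (Suc n) x) y)"
    by (simp add: ennreal_pmf_bind ennreal_mult)
  finally show ?case .
qed

end

section \<open>Cauchy--Schwarz and reflection of the threshold\<close>

text \<open>A quadratic polynomial in \<open>t\<close>, the second moment of \<open>f - t g\<close>, is nonnegative everywhere, so
  its discriminant is not positive.\<close>
lemma (in prob_space) expectation_Cauchy_Schwarz:
  fixes f g :: "'a \<Rightarrow> real"
  assumes [simp]: "integrable M (\<lambda>x. (f x)\<^sup>2)" "integrable M (\<lambda>x. (g x)\<^sup>2)" "integrable M (\<lambda>x. f x * g x)"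
  shows "expectation (\<lambda>x. f x * g x) \<le> sqrt (expectation (\<lambda>x. (f x)\<^sup>2)) * sqrt (expectation (\<lambda>x. (g x)\<^sup>2))"
proof -
  define a b c where "a = expectation (\<lambda>x. (f x)\<^sup>2)" and "b = expectation (\<lambda>x. f x * g x)"
    and "c = expectation (\<lambda>x. (g x)\<^sup>2)"
  have quad: "0 \<le> a - 2 * t * b + t\<^sup>2 * c" for t
  proof -
    have "0 \<le> expectation (\<lambda>x. (f x - t * g x)\<^sup>2)" by (intro integral_nonneg_AE) auto
    also have "\<dots> = expectation (\<lambda>x. (f x)\<^sup>2 - (2 * t) * (f x * g x) + t\<^sup>2 * (g x)\<^sup>2)"
      by (intro Bochner_Integration.integral_cong) (auto simp: power2_eq_square algebra_simps)
    also have "\<dots> = a - 2 * t * b + t\<^sup>2 * c" by (simp add: a_def b_def c_def)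
    finally show ?thesis .
  qed
  have "c \<ge> 0" unfolding c_def by (intro integral_nonneg_AE) auto
  have "b\<^sup>2 \<le> a * c"
  proof (cases "c = 0")
    case True
    have "b = 0"
    proof (rule ccontr)
      assume "b \<noteq> 0"
      \<comment> \<open>At this value of \<open>t\<close> the polynomial, now affine, equals \<open>-1\<close>.\<close>
      then have "2 * ((a + 1) / (2 * b)) * b = a + 1" by simp
      then show False using quad[of "(a + 1) / (2 * b)"] True by simp
    qed
    then show ?thesis using True by simp
  next
    case False
    have "a - 2 * (b / c) * b + (b / c)\<^sup>2 * c = a - b\<^sup>2 / c"
      using False by (simp add: power2_eq_square field_simps)
    then have "b\<^sup>2 / c \<le> a" using quad[of "b / c"] by simp
    then show ?thesis using False \<open>c \<ge> 0\<close> by (simp add: field_simps)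
  qed
  then have "b \<le> sqrt (a * c)" by (rule real_le_rsqrt)
  then show ?thesis by (simp add: a_def b_def c_def real_sqrt_mult)
qed

lemma integral_unif_reflect:
  fixes f :: "real \<Rightarrow> real"
  assumes [measurable]: "f \<in> borel_measurable borel"
  shows "(\<integral>u. f (1 - u) \<partial>unif) = (\<integral>u. f u \<partial>unif)"
proof -
  have unif_eq: "unif = density lborel (\<lambda>u. ennreal (indicator {0..1} u))"
    unfolding uniform_measure_def by (intro density_cong) (auto simp: indicator_def divide_ennreal simp flip: ennreal_1)
  have "(\<integral>u. f u \<partial>unif) = (\<integral>u. indicator {0..1} u * f u \<partial>lborel)"
    unfolding unif_eq by (subst integral_real_density) auto
  also have "\<dots> = (\<integral>u. indicator {0..1} (1 - u) * f (1 - u) \<partial>lborel)"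
    by (subst lborel_integral_real_affine[of "-1" _ 1]) auto
  also have "\<dots> = (\<integral>u. indicator {0..1} u * f (1 - u) \<partial>lborel)"
    by (intro Bochner_Integration.integral_cong) (auto simp: indicator_def)
  also have "\<dots> = (\<integral>u. f (1 - u) \<partial>unif)"
    unfolding unif_eq by (subst integral_real_density) auto
  finally show ?thesis by simp
qed

section \<open>Contraction of the root gauge\<close>

context stationary_chain
begin

lemma mass_pos: "S \<noteq> {} \<Longrightarrow> mass S > 0"
proof -
  assume "S \<noteq> {}"
  then obtain y where "y \<in> S" by auto
  then have "pmf \<pi> y \<le> mass S"
    unfolding measure_pmf_single[symmetric] by (intro measure_pmf.finite_measure_mono) auto
  then show ?thesis using pmf_pos[of y] by linarith
qed

lemma mass_Compl: "mass (- S) = 1 - mass S"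
  using measure_pmf.prob_compl[of S \<pi>] by (simp add: Compl_eq_Diff_UNIV)

lemma measurable_mass_evolve [measurable]: "(\<lambda>u. mass (evolve p \<pi> S u)) \<in> borel_measurable borel"
proof -
  have "(\<lambda>u. mass (evolve p \<pi> S u)) \<in> borel_measurable unif" by measurable
  then show ?thesis by simp
qed

lemma integrable_bounded_unif:
  assumes "f \<in> borel_measurable borel" "\<And>u. \<bar>f u\<bar> \<le> B"
  shows "integrable unif (f :: real \<Rightarrow> real)"
  using assms by (intro unif.integrable_const_bound[where B=B]) auto

lemma integrable_mass_evolve: "integrable unif (\<lambda>u. mass (evolve p \<pi> S u))"
  by (rule integrable_bounded_unif[where B=1]) auto

lemma integrable_sqrt_mass_evolve: "integrable unif (\<lambda>u. sqrt (mass (evolve p \<pi> S u)))"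
  by (rule integrable_bounded_unif[where B=1]) auto

lemma integral_mass_evolve: "(\<integral>u. mass (evolve p \<pi> S u) \<partial>unif) = mass S"
  using nn_integral_mass_evolve[of S] nn_integral_eq_integral[OF integrable_mass_evolve, of S]
  by (simp add: integral_nonneg_AE)

text \<open>The square root of the mass ratio is bounded by the arithmetic mean of \<open>1\<close> and the ratio,
  and the ratio has mean one. For the empty set, division by zero
  makes the ratio \<open>0\<close>, so that \<open>\<psi> = 1\<close>.\<close>
lemma psi_set_nonneg: "psi_set p \<pi> S \<ge> 0"
proof (cases "S = {}")
  case True
  then show ?thesis by (simp add: psi_set_def)
next
  case False
  have "sqrt (mass (evolve p \<pi> S u) / mass S) \<le> (1 + mass (evolve p \<pi> S u) / mass S) / 2" for u
    using arith_geo_mean_sqrt[of 1 "mass (evolve p \<pi> S u) / mass S"] by simp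
  then have "(\<integral>u. sqrt (mass (evolve p \<pi> S u) / mass S) \<partial>unif)
      \<le> (\<integral>u. (1 + mass (evolve p \<pi> S u) / mass S) / 2 \<partial>unif)"
    using integrable_mass_evolve[of S] integrable_sqrt_mass_evolve[of S]
    by (intro integral_mono) (auto simp: real_sqrt_divide)
  also have "\<dots> = 1"
    using integrable_mass_evolve[of S] mass_pos[OF False] unif.prob_space
    by (simp add: integral_mass_evolve del: measure_uniform_measure)
  finally show ?thesis by (simp add: psi_set_def)
qed

lemma integral_sqrt_mass_evolve:
  "(\<integral>u. sqrt (mass (evolve p \<pi> S u)) \<partial>unif) = sqrt (mass S) * (1 - psi_set p \<pi> S)"
proof (cases "S = {}")
  case True
  have "AE u in unif. mass (evolve p \<pi> S u) = 0"
    using integral_nonneg_eq_0_iff_AE[OF integrable_mass_evolve[of S]] integral_mass_evolve[of S] True by simp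
  then have "(\<integral>u. sqrt (mass (evolve p \<pi> S u)) \<partial>unif) = 0"
    by (intro integral_eq_zero_AE) auto
  then show ?thesis using True by simp
next
  case False
  then show ?thesis using mass_pos[of S] by (simp add: psi_set_def real_sqrt_divide)
qed

definition smaller_side :: "'a set \<Rightarrow> 'a set" where
  "smaller_side S = (if mass S \<le> 1/2 then S else - S)"

text \<open>Up to a factor of at most \<open>sqrt 2\<close>, the standard deviation of the indicator of \<open>S\<close> under
  \<open>\<pi>\<close>. In this form it is the square root of a mass, and this is the quantity that \<open>psi_set\<close>
  controls.\<close>
definition root_gauge :: "'a set \<Rightarrow> real" where
  "root_gauge S = sqrt (mass (smaller_side S))"

lemma mass_smaller_side: "mass (smaller_side S) = min (mass S) (1 - mass S)"
  by (auto simp: smaller_side_def mass_Compl)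

lemma root_gauge_nonneg [simp]: "root_gauge S \<ge> 0"
  by (simp add: root_gauge_def)

lemma root_gauge_le_1: "root_gauge S \<le> 1"
  by (simp add: root_gauge_def)

lemma measurable_root_gauge [measurable]: "root_gauge \<in> borel_measurable subset_space"
proof -
  have "(\<lambda>S. sqrt (min (mass S) (1 - mass S))) \<in> borel_measurable subset_space" by measurable
  then show ?thesis by (simp add: root_gauge_def[abs_def] mass_smaller_side)
qed

lemma measurable_root_gauge_evolve [measurable]: "(\<lambda>u. root_gauge (evolve p \<pi> S u)) \<in> borel_measurable borel"
proof -
  have "(\<lambda>u. root_gauge (evolve p \<pi> S u)) \<in> borel_measurable unif" by measurable
  then show ?thesis by simp
qed

text \<open>By stationarity, the points that fail the threshold \<open>u\<close> for \<open>S\<close> pass the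
  threshold \<open>1 - u\<close> for the complement.\<close>
lemma Compl_evolve_subset: "- evolve p \<pi> S u \<subseteq> evolve p \<pi> (- S) (1 - u)"
proof
  fix y assume "y \<in> - evolve p \<pi> S u"
  then have "Q_set p \<pi> S y < u * pmf \<pi> y" by (simp add: evolve_def)
  then have "Q_set p \<pi> (- S) y \<ge> (1 - u) * pmf \<pi> y"
    using Q_set_Compl[of S y] by (simp add: algebra_simps)
  then show "y \<in> evolve p \<pi> (- S) (1 - u)" by (simp add: evolve_def)
qed

text \<open>If the smaller side is the complement, the evolution of the complement with reflected
  threshold covers the complement of the evolution, and reflection does not change the uniform
  law.\<close>
lemma integral_root_gauge_evolve:
  "(\<integral>u. root_gauge (evolve p \<pi> S u) \<partial>unif) \<le> root_gauge S * (1 - psi_set p \<pi> (smaller_side S))"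
proof -
  have int: "integrable unif (\<lambda>u. root_gauge (evolve p \<pi> S u))"
    by (rule integrable_bounded_unif[where B=1]) (auto simp: root_gauge_le_1)
  have "(\<integral>u. root_gauge (evolve p \<pi> S u) \<partial>unif)
     \<le> (\<integral>u. sqrt (mass (evolve p \<pi> (smaller_side S) u)) \<partial>unif)"
  proof (cases "mass S \<le> 1/2")
    case True
    then show ?thesis
      using int integrable_sqrt_mass_evolve
      by (intro integral_mono) (auto simp: root_gauge_def mass_smaller_side smaller_side_def[of S])
  next
    case False
    have "mass (- evolve p \<pi> S u) \<le> mass (evolve p \<pi> (- S) (1 - u))" for u
      by (intro measure_pmf.finite_measure_mono Compl_evolve_subset) simp
    then have "root_gauge (evolve p \<pi> S u) \<le> sqrt (mass (evolve p \<pi> (- S) (1 - u)))" for u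
      by (auto simp: root_gauge_def mass_smaller_side mass_Compl intro: min.coboundedI2)
    then have "(\<integral>u. root_gauge (evolve p \<pi> S u) \<partial>unif)
        \<le> (\<integral>u. sqrt (mass (evolve p \<pi> (- S) (1 - u))) \<partial>unif)"
      using int by (intro integral_mono integrable_bounded_unif[where B=1]) (auto simp: root_gauge_le_1)
    also have "\<dots> = (\<integral>u. sqrt (mass (evolve p \<pi> (- S) u)) \<partial>unif)"
      by (rule integral_unif_reflect) measurable
    finally show ?thesis using False by (simp add: smaller_side_def)
  qed
  then show ?thesis by (simp add: integral_sqrt_mass_evolve root_gauge_def)
qed

text \<open>A linear lower bound for the gain, valid for every set. If the gauge of \<open>S\<close> is at
  most \<open>t\<close> times the mass, the claimed gain is not positive. Otherwise the smaller side has mass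
  at most \<open>1/t\<^sup>2\<close>, and the root profile at that level bounds its \<open>\<psi>\<close> from below. Being linear in
  gauge and mass, the bound survives averaging over random sets.\<close>
lemma root_gauge_drift:
  assumes "t > 0" "c \<ge> 0" "ereal c \<le> root_profile p \<pi> (1 / t\<^sup>2)"
  shows "(\<integral>u. root_gauge (evolve p \<pi> S u) \<partial>unif) \<le> root_gauge S - c * (root_gauge S - t * mass S)"
proof -
  let ?m = "mass (smaller_side S)"
  have "c * (root_gauge S - t * mass S) \<le> root_gauge S * psi_set p \<pi> (smaller_side S)"
  proof (cases "root_gauge S \<le> t * mass S")
    case True
    then have "c * (root_gauge S - t * mass S) \<le> 0"
      using \<open>c \<ge> 0\<close> by (simp add: mult_nonneg_nonpos)
    also have "0 \<le> root_gauge S * psi_set p \<pi> (smaller_side S)"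
      by (simp add: psi_set_nonneg)
    finally show ?thesis .
  next
    case False
    then have "root_gauge S > 0" using \<open>t > 0\<close>
      by (smt (verit) measure_nonneg mult_nonneg_nonneg)
    then have "smaller_side S \<noteq> {}" by (auto simp: root_gauge_def)
    moreover have "?m \<le> 1/2" by (simp add: mass_smaller_side min_def)
    moreover have "?m \<le> 1 / t\<^sup>2"
    proof -
      have "t * ?m \<le> t * mass S" using \<open>t > 0\<close> by (simp add: mass_smaller_side)
      with False have "t * ?m \<le> sqrt ?m" by (simp add: root_gauge_def)
      then have "(t * ?m)\<^sup>2 \<le> (sqrt ?m)\<^sup>2"
        using \<open>t > 0\<close> by (intro power_mono) auto
      then have "t\<^sup>2 * ?m * ?m \<le> 1 * ?m" by (simp add: power2_eq_square ac_simps)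
      moreover have "?m > 0" using \<open>root_gauge S > 0\<close> by (simp add: root_gauge_def)
      ultimately have "t\<^sup>2 * ?m \<le> 1" by (simp only: mult_le_cancel_right_pos)
      then show ?thesis using \<open>t > 0\<close> by (simp add: field_simps)
    qed
    ultimately have "root_profile p \<pi> (1 / t\<^sup>2) \<le> ereal (psi_set p \<pi> (smaller_side S))"
      unfolding root_profile_def by (intro INF_lower) auto
    with assms(3) have "c \<le> psi_set p \<pi> (smaller_side S)"
      using order_trans ereal_less_eq(3) by blast
    then have "c * root_gauge S \<le> root_gauge S * psi_set p \<pi> (smaller_side S)"
      by (subst mult.commute) (rule mult_left_mono, simp_all)
    moreover have "0 \<le> c * (t * mass S)" using assms by simp
    ultimately show ?thesis by (simp add: algebra_simps)
  qed
  then show ?thesis using integral_root_gauge_evolve[of S] by (simp add: algebra_simps)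
qed

section \<open>Decay of the mean gauge\<close>

lemma measurable_evolving_law_iff: "f \<in> evolving_law n x \<rightarrow>\<^sub>M M \<longleftrightarrow> f \<in> subset_space \<rightarrow>\<^sub>M M"
  by (simp add: measurable_cong_sets[OF sets_evolving_law refl])

lemma integrable_evolving_law:
  assumes "f \<in> borel_measurable subset_space" "\<And>S. \<bar>f S\<bar> \<le> B"
  shows "integrable (evolving_law n x) (f :: 'a set \<Rightarrow> real)"
  using assms
  by (intro finite_measure.integrable_const_bound[where B=B] prob_space.finite_measure[OF prob_space_evolving_law])
     (auto simp: measurable_evolving_law_iff)

lemma integral_evolving_law_Suc:
  fixes f :: "'a set \<Rightarrow> real"
  assumes [measurable]: "f \<in> borel_measurable subset_space" and "\<And>S. 0 \<le> f S" "\<And>S. f S \<le> 1"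
  shows "(\<integral>S. f S \<partial>evolving_law (Suc n) x)
       = (\<integral>S. (\<integral>u. f (evolve p \<pi> S u) \<partial>unif) \<partial>evolving_law n x)"
    and "(\<lambda>S. \<integral>u. f (evolve p \<pi> S u) \<partial>unif) \<in> borel_measurable subset_space"
    and "\<And>S. 0 \<le> (\<integral>u. f (evolve p \<pi> S u) \<partial>unif)"
    and "\<And>S. (\<integral>u. f (evolve p \<pi> S u) \<partial>unif) \<le> 1"
proof -
  have int: "integrable unif (\<lambda>u. f (evolve p \<pi> S u))" for S
    using assms by (intro unif.integrable_const_bound[where B=1]) auto
  show meas: "(\<lambda>S. \<integral>u. f (evolve p \<pi> S u) \<partial>unif) \<in> borel_measurable subset_space"
    by (rule unif.borel_measurable_lebesgue_integral) measurable
  show nn: "0 \<le> (\<integral>u. f (evolve p \<pi> S u) \<partial>unif)" for S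
    using assms by (intro integral_nonneg_AE) auto
  show le: "(\<integral>u. f (evolve p \<pi> S u) \<partial>unif) \<le> 1" for S
    using assms int by (intro unif.integral_le_const) auto
  have "ennreal (\<integral>S. f S \<partial>evolving_law (Suc n) x) = (\<integral>\<^sup>+S. ennreal (f S) \<partial>evolving_law (Suc n) x)"
    using assms by (intro nn_integral_eq_integral[symmetric] integrable_evolving_law[where B=1]) auto
  also have "\<dots> = (\<integral>\<^sup>+S. ennreal (\<integral>u. f (evolve p \<pi> S u) \<partial>unif) \<partial>evolving_law n x)"
    using assms int by (subst nn_integral_evolving_law_Suc) (auto simp: nn_integral_eq_integral)
  also have "\<dots> = ennreal (\<integral>S. (\<integral>u. f (evolve p \<pi> S u) \<partial>unif) \<partial>evolving_law n x)"
    using nn le meas by (intro nn_integral_eq_integral integrable_evolving_law[where B=1]) auto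
  finally show "(\<integral>S. f S \<partial>evolving_law (Suc n) x)
       = (\<integral>S. (\<integral>u. f (evolve p \<pi> S u) \<partial>unif) \<partial>evolving_law n x)"
    using assms nn by (subst (asm) ennreal_inj) (auto intro!: integral_nonneg_AE)
qed

lemma integral_mass_evolving_law: "(\<integral>S. mass S \<partial>evolving_law n x) = pmf \<pi> x"
proof -
  have "ennreal (\<integral>S. mass S \<partial>evolving_law n x) = ennreal (pmf \<pi> x)"
    using nn_integral_mass_evolving_law[of n x]
      nn_integral_eq_integral[OF integrable_evolving_law[of mass 1 n x]] by simp
  then show ?thesis by (subst (asm) ennreal_inj) (auto intro!: integral_nonneg_AE)
qed

text \<open>Division by \<open>\<pi>(x)\<close> makes this the mean of \<open>root_gauge S / \<pi>(S)\<close> under the Doob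
  transform of the set process by the martingale \<open>\<pi>(S\<^sub>n)\<close>. It is also the normalisation that bounds the
  chi-square distance.\<close>
definition mean_gauge :: "nat \<Rightarrow> 'a \<Rightarrow> real" where
  "mean_gauge n x = (\<integral>S. root_gauge S \<partial>evolving_law n x) / pmf \<pi> x"

lemma mean_gauge_nonneg: "mean_gauge n x \<ge> 0"
  unfolding mean_gauge_def by (auto intro!: divide_nonneg_nonneg integral_nonneg_AE)

lemma mean_gauge_0: "(mean_gauge 0 x)\<^sup>2 \<le> 1 / pmf \<pi> x"
proof -
  have "(\<integral>S. root_gauge S \<partial>evolving_law 0 x) = root_gauge {x}"
    by (simp add: integral_return)
  then have "(mean_gauge 0 x)\<^sup>2 = mass (smaller_side {x}) / (pmf \<pi> x)\<^sup>2"
    by (simp add: mean_gauge_def power_divide root_gauge_def)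
  also have "\<dots> \<le> pmf \<pi> x / (pmf \<pi> x)\<^sup>2"
    by (intro divide_right_mono) (auto simp: mass_smaller_side measure_pmf_single)
  finally show ?thesis using pmf_pos[of x] by (simp add: power2_eq_square)
qed

text \<open>The averaged drift. For \<open>c = 0\<close> it says that the mean gauge never increases.\<close>
lemma mean_gauge_Suc_le:
  assumes "t > 0" "c \<ge> 0" "ereal c \<le> root_profile p \<pi> (1 / t\<^sup>2)"
  shows "mean_gauge (Suc n) x \<le> mean_gauge n x - c * (mean_gauge n x - t)"
proof -
  note gauge = measurable_root_gauge root_gauge_nonneg root_gauge_le_1
  have int: "integrable (evolving_law n x) root_gauge" "integrable (evolving_law n x) mass"
    by (auto intro!: integrable_evolving_law[where B=1] simp: root_gauge_le_1)
  have "(\<integral>S. root_gauge S \<partial>evolving_law (Suc n) x)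
      = (\<integral>S. (\<integral>u. root_gauge (evolve p \<pi> S u) \<partial>unif) \<partial>evolving_law n x)"
    by (rule integral_evolving_law_Suc[OF gauge])
  also have "\<dots> \<le> (\<integral>S. root_gauge S - c * (root_gauge S - t * mass S) \<partial>evolving_law n x)"
  proof (rule integral_mono)
    show "integrable (evolving_law n x) (\<lambda>S. \<integral>u. root_gauge (evolve p \<pi> S u) \<partial>unif)"
      using integral_evolving_law_Suc(2-4)[OF gauge]
      by (intro integrable_evolving_law[where B=1]) auto
    show "integrable (evolving_law n x) (\<lambda>S. root_gauge S - c * (root_gauge S - t * mass S))"
      using int by auto
    show "(\<integral>u. root_gauge (evolve p \<pi> S u) \<partial>unif) \<le> root_gauge S - c * (root_gauge S - t * mass S)" for S
      by (rule root_gauge_drift[OF assms])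
  qed
  also have "\<dots> = (\<integral>S. root_gauge S \<partial>evolving_law n x)
      - c * ((\<integral>S. root_gauge S \<partial>evolving_law n x) - t * pmf \<pi> x)"
    using int by (simp add: integral_mass_evolving_law)
  also have "\<dots> = pmf \<pi> x * (mean_gauge n x - c * (mean_gauge n x - t))"
    using pmf_pos[of x] by (simp add: mean_gauge_def field_simps)
  finally show ?thesis
    using pmf_pos[of x] by (simp add: mean_gauge_def pos_divide_le_eq mult.commute)
qed

text \<open>The choice \<open>t = L\<^sub>n/2\<close> keeps half of the mean gauge above the threshold, since
  the mean mass stays \<open>\<pi>(x)\<close>.\<close>
lemma mean_gauge_Suc:
  assumes "mean_gauge n x > 0" "c \<ge> 0" "ereal c \<le> root_profile p \<pi> (4 / (mean_gauge n x)\<^sup>2)"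
  shows "mean_gauge (Suc n) x \<le> mean_gauge n x * (1 - c / 2)"
  using mean_gauge_Suc_le[of "mean_gauge n x / 2" c n x] assms
  by (simp add: power_divide algebra_simps)

section \<open>The chi-square distance and the mean gauge\<close>

lemma integral_indicator_evolving_law:
  "(\<integral>S. indicator S y \<partial>evolving_law n x) = pmf \<pi> x * pmf (nstep p n x) y / pmf \<pi> y"
proof -
  have m: "(\<lambda>S. indicator S y :: real) \<in> borel_measurable subset_space" by measurable
  have "(\<integral>\<^sup>+S. indicator S y \<partial>evolving_law n x) = (\<integral>\<^sup>+S. ennreal (indicator S y) \<partial>evolving_law n x)"
    by (intro nn_integral_cong) (auto simp: indicator_def)
  also have "\<dots> = ennreal (\<integral>S. indicator S y \<partial>evolving_law n x)"
    using m by (intro nn_integral_eq_integral integrable_evolving_law[where B=1]) (auto simp: indicator_def)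
  finally have "ennreal (pmf \<pi> y * (\<integral>S. indicator S y \<partial>evolving_law n x))
      = ennreal (pmf \<pi> x * pmf (nstep p n x) y)"
    using evolving_law_duality[of y n x] by (simp add: ennreal_mult')
  then have "pmf \<pi> y * (\<integral>S. indicator S y \<partial>evolving_law n x) = pmf \<pi> x * pmf (nstep p n x) y"
    by (subst (asm) ennreal_inj) (auto intro!: mult_nonneg_nonneg integral_nonneg_AE)
  then show ?thesis using pmf_pos[of y] by (simp add: field_simps)
qed

text \<open>The variance of an indicator of probability \<open>m\<close> is \<open>m (1 - m)\<close>.\<close>
lemma variance_indicator_le: "(\<integral>y. (indicator S y - mass S)\<^sup>2 \<partial>\<pi>) \<le> mass (smaller_side S)"
proof -
  have "(\<integral>y. (indicator S y - mass S)\<^sup>2 \<partial>\<pi>)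
      = (\<integral>y. (1 - 2 * mass S) * indicator S y + (mass S)\<^sup>2 \<partial>\<pi>)"
    by (intro Bochner_Integration.integral_cong) (auto simp: indicator_def power2_eq_square algebra_simps)
  also have "\<dots> = (1 - 2 * mass S) * mass S + (mass S)\<^sup>2"
    by (subst Bochner_Integration.integral_add)
       (auto simp: measure_pmf.integrable_const_bound[where B=1])
  also have "\<dots> = mass S * (1 - mass S)" by (simp add: power2_eq_square algebra_simps)
  also have "\<dots> \<le> min (mass S) (1 - mass S)"
    using mult_left_le[of "mass S" "1 - mass S"] mult_left_le[of "1 - mass S" "mass S"]
    by (simp add: mult.commute)
  finally show ?thesis by (simp add: mass_smaller_side)
qed

text \<open>With \<open>\<rho>\<close> the density of \<open>p\<^sup>n(x,\<cdot>)\<close> minus one and \<open>D\<close> its norm in \<open>L\<^sup>2(\<pi>)\<close>, duality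
  writes \<open>\<rho>\<close> as an average of centred indicators. Pairing this average with \<open>\<rho>\<close>
  itself and applying Cauchy--Schwarz set by set gives \<open>D\<^sup>2 \<le> D L\<^sub>n\<close>. Cancelling \<open>D\<close> is legitimate because
  \<open>\<rho>\<close> is bounded, which also justifies the exchange of integrals.\<close>
lemma chi_square_le_mean_gauge: "chi_square (nstep p n x) \<pi> \<le> ennreal ((mean_gauge n x)\<^sup>2)"
proof -
  define \<rho> where "\<rho> y = pmf (nstep p n x) y / pmf \<pi> y - 1" for y
  define D where "D = sqrt (\<integral>y. (\<rho> y)\<^sup>2 \<partial>\<pi>)"
  let ?N = "evolving_law n x"
  interpret N: prob_space ?N by (rule prob_space_evolving_law)
  interpret P: pair_prob_space ?N "measure_pmf \<pi>" ..
  have mi: "(\<lambda>S. indicator S y :: real) \<in> borel_measurable subset_space" for y by measurable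
  have ii: "integrable ?N (\<lambda>S. indicator S y :: real)" for y
    using mi by (intro integrable_evolving_law[where B=1]) (auto simp: indicator_def)
  have im: "integrable ?N mass" by (rule integrable_evolving_law[where B=1]) auto
  have dev: "\<bar>indicator S y - mass S\<bar> \<le> 1" for S :: "'a set" and y
    proof -
    have "indicator S y = (0 :: real) \<or> indicator S y = (1 :: real)" by (simp add: indicator_def)
    then show ?thesis
      using measure_pmf.prob_le_1[of \<pi> S] measure_nonneg[of \<pi> S] by linarith
  qed
  have \<rho>: "\<rho> y = (\<integral>S. indicator S y - mass S \<partial>?N) / pmf \<pi> x" for y
    using ii im pmf_pos[of x]
    by (simp add: integral_indicator_evolving_law integral_mass_evolving_law \<rho>_def diff_divide_distrib)
  have \<rho>_le: "\<bar>\<rho> y\<bar> \<le> 1 / pmf \<pi> x" for y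
  proof -
    have "\<bar>\<integral>S. indicator S y - mass S \<partial>?N\<bar> \<le> (\<integral>S. \<bar>indicator S y - mass S\<bar> \<partial>?N)"
      by (rule integral_abs_bound)
    also have "\<dots> \<le> 1" using ii im dev by (intro N.integral_le_const) auto
    finally show ?thesis using pmf_pos[of x] by (simp add: \<rho> divide_right_mono)
  qed
  have int\<rho>: "integrable \<pi> (\<lambda>y. (\<rho> y)\<^sup>2)"
    using power_mono[OF \<rho>_le abs_ge_zero, of _ 2]
    by (intro measure_pmf.integrable_const_bound[where B="(1 / pmf \<pi> x)\<^sup>2"]) auto
  have int2: "integrable \<pi> (\<lambda>y. (indicator S y - mass S)\<^sup>2)" for S
    using power_mono[OF dev abs_ge_zero, of _ _ 2]
    by (intro measure_pmf.integrable_const_bound[where B=1]) auto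
  have prod_le: "\<bar>\<rho> y * (indicator S y - mass S)\<bar> \<le> 1 / pmf \<pi> x" for S y
    using mult_mono[OF \<rho>_le[of y] dev[of S y]] pmf_pos[of x] by (simp add: abs_mult)
  have int3: "integrable \<pi> (\<lambda>y. \<rho> y * (indicator S y - mass S))" for S
    using prod_le by (intro measure_pmf.integrable_const_bound[where B="1 / pmf \<pi> x"]) auto
  have D2: "D\<^sup>2 = (\<integral>y. (\<rho> y)\<^sup>2 \<partial>\<pi>)" and "D \<ge> 0"
    unfolding D_def by (auto intro!: real_sqrt_pow2 integral_nonneg_AE)
  have meas: "(\<lambda>(S, y). \<rho> y * (indicator S y - mass S)) \<in> borel_measurable (?N \<Otimes>\<^sub>M measure_pmf \<pi>)"
  proof -
    have "(\<lambda>z. \<rho> (snd z) * ((\<lambda>(S, y). indicator S y) z - mass (fst z)))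
        \<in> borel_measurable (subset_space \<Otimes>\<^sub>M measure_pmf \<pi>)"
      by (intro borel_measurable_times borel_measurable_diff measurable_indicator_pair
           measurable_compose[OF measurable_fst measurable_mass] measurable_compose[OF measurable_snd]) simp
    then show ?thesis
      by (simp add: case_prod_beta' measurable_cong_sets[OF sets_pair_measure_cong[OF sets_evolving_law refl] refl])
  qed
  have intP: "integrable (?N \<Otimes>\<^sub>M measure_pmf \<pi>) (\<lambda>(S, y). \<rho> y * (indicator S y - mass S))"
    by (rule P.integrable_const_bound[where B="1 / pmf \<pi> x", OF _ meas]) (use prod_le in auto)
  have "pmf \<pi> x * D\<^sup>2 = (\<integral>y. (\<integral>S. \<rho> y * (indicator S y - mass S) \<partial>?N) \<partial>\<pi>)"
  proof -
    have "pmf \<pi> x * (\<rho> y)\<^sup>2 = (\<integral>S. \<rho> y * (indicator S y - mass S) \<partial>?N)" for y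
      using pmf_pos[of x] \<rho>[of y] by (simp add: power2_eq_square)
    then show ?thesis unfolding D2 by (simp flip: integral_mult_right_zero)
  qed
  also have "\<dots> = (\<integral>S. (\<integral>y. \<rho> y * (indicator S y - mass S) \<partial>\<pi>) \<partial>?N)"
    by (rule P.Fubini_integral[OF intP])
  also have "\<dots> \<le> (\<integral>S. D * root_gauge S \<partial>?N)"
  proof (rule integral_mono)
    show "integrable ?N (\<lambda>S. \<integral>y. \<rho> y * (indicator S y - mass S) \<partial>\<pi>)"
      by (rule P.integrable_fst[OF intP])
    show "integrable ?N (\<lambda>S. D * root_gauge S)"
      by (intro integrable_mult_right integrable_evolving_law[where B=1]) (auto simp: root_gauge_le_1)
    fix S
    have "(\<integral>y. \<rho> y * (indicator S y - mass S) \<partial>\<pi>) \<le> D * sqrt (\<integral>y. (indicator S y - mass S)\<^sup>2 \<partial>\<pi>)"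
      unfolding D_def by (rule measure_pmf.expectation_Cauchy_Schwarz[OF int\<rho> int2 int3])
    also have "\<dots> \<le> D * root_gauge S"
      using \<open>D \<ge> 0\<close> variance_indicator_le[of S] unfolding root_gauge_def
      by (intro mult_left_mono) auto
    finally show "(\<integral>y. \<rho> y * (indicator S y - mass S) \<partial>\<pi>) \<le> D * root_gauge S" .
  qed
  also have "\<dots> = pmf \<pi> x * (D * mean_gauge n x)"
    using pmf_pos[of x] by (simp add: mean_gauge_def)
  finally have "D * D \<le> D * mean_gauge n x"
    using pmf_pos[of x] by (simp add: power2_eq_square)
  then have "D \<le> mean_gauge n x"
    using \<open>D \<ge> 0\<close> mean_gauge_nonneg[of n x] by (cases "D = 0") auto
  have "chi_square (nstep p n x) \<pi> = (\<integral>\<^sup>+y. ennreal ((\<rho> y)\<^sup>2) \<partial>\<pi>)"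
    by (simp add: chi_square_def nn_integral_measure_pmf \<rho>_def ennreal_mult)
  also have "\<dots> = ennreal (D\<^sup>2)"
    unfolding D2 using int\<rho> by (intro nn_integral_eq_integral) auto
  also have "\<dots> \<le> ennreal ((mean_gauge n x)\<^sup>2)"
    using \<open>D \<ge> 0\<close> \<open>D \<le> mean_gauge n x\<close> by (intro ennreal_leI power_mono)
  finally show ?thesis .
qed

end

section \<open>Integrating a decreasing profile\<close>

lemma borel_measurable_antimono_ereal:
  fixes \<psi> :: "real \<Rightarrow> ereal"
  assumes "antimono \<psi>"
  shows "\<psi> \<in> borel_measurable borel"
proof (rule borel_measurableI_less)
  fix y
  have "is_interval {u. \<psi> u < y}"
    unfolding is_interval_1 using antimonoD[OF assms] by (blast intro: le_less_trans)
  then show "{u \<in> space borel. \<psi> u < y} \<in> sets borel"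
    by (simp add: real_interval_borel_measurable)
qed

text \<open>If the profile vanishes at \<open>u\<close>, the right-hand side is \<open>1/0 = \<infinity>\<close>.\<close>
lemma inverse_profile_ge:
  fixes \<psi> :: "real \<Rightarrow> ereal"
  assumes "0 < u" "0 \<le> \<psi> u" "\<psi> u \<le> ereal c" "0 < c"
  shows "ennreal (1 / c / u) \<le> e2ennreal (1 / (ereal u * \<psi> u))"
proof (cases "\<psi> u")
  case (real d)
  show ?thesis
  proof (cases "d = 0")
    case True
    then have "1 / (ereal u * \<psi> u) = \<infinity>"
      using real by (simp add: zero_ereal_def[symmetric] divide_ereal_def)
    then show ?thesis by (simp only: e2ennreal_infty top_greatest)
  next
    case False
    then have "0 < d" "d \<le> c" using real assms by auto
    then have "1 / c / u \<le> 1 / (u * d)" using assms by (simp add: frac_le mult.commute)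
    then show ?thesis using real assms \<open>0 < d\<close>
      by (simp add: one_ereal_def flip: ennreal.rep_eq)
  qed
qed (use assms in auto)

lemma nn_integral_inverse_Icc:
  assumes "0 < a" "a \<le> b" "0 < (c::real)"
  shows "(\<integral>\<^sup>+u. ennreal (1 / c / u) * indicator {a..b} u \<partial>lborel) = ennreal (ln (b / a) / c)"
proof -
  have "(\<integral>\<^sup>+u. ennreal (1 / c / u) * indicator {a..b} u \<partial>lborel) = ennreal (ln b / c - ln a / c)"
    using assms by (intro nn_integral_FTC_Icc)
      (auto intro!: derivative_eq_intros simp: field_simps)
  then show ?thesis using assms by (simp add: ln_div diff_divide_distrib)
qed

text \<open>On \<open>[a\<^sub>k, a\<^bsub>k+1\<^esub>]\<close> the profile is at most \<open>c = \<psi>(a\<^sub>k)\<close>, so the integral over this piece is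
  at least \<open>ln (a\<^bsub>k+1\<^esub>/a\<^sub>k)/c \<ge> 1\<close>. The final piece up to \<open>b\<close> has positive
  integral and makes the inequality strict. If \<open>\<psi>(a\<^sub>k) = 0\<close>, the sequence may stall at
  \<open>a\<^sub>k\<close>, but then the integrand is infinite on all of \<open>[a\<^sub>k, b]\<close>.\<close>
lemma lt_nn_integral_inverse_profile:
  fixes \<psi> :: "real \<Rightarrow> ereal" and a :: "nat \<Rightarrow> real"
  assumes anti: "antimono \<psi>" and nonneg: "\<And>u. 0 \<le> \<psi> u"
    and pos: "\<And>k. k \<le> n \<Longrightarrow> 0 < a k" and fin: "\<And>k. k \<le> n \<Longrightarrow> \<psi> (a k) \<noteq> \<infinity>"
    and step: "\<And>k c. k < n \<Longrightarrow> 0 \<le> c \<Longrightarrow> ereal c \<le> \<psi> (a k) \<Longrightarrow> a k * exp c \<le> a (Suc k)"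
    and last: "a n < b"
  shows "ennreal (real n) < (\<integral>\<^sup>+u\<in>{a 0..b}. e2ennreal (1 / (ereal u * \<psi> u)) \<partial>lborel)"
proof -
  define g where "g u = e2ennreal (1 / (ereal u * \<psi> u))" for u
  have [measurable]: "\<psi> \<in> borel_measurable borel"
    by (rule borel_measurable_antimono_ereal[OF anti])
  have [measurable]: "g \<in> borel_measurable borel"
    unfolding g_def by measurable
  have piece: "ennreal (ln (v / a k) / c) \<le> (\<integral>\<^sup>+u\<in>{a k..v}. g u \<partial>lborel)"
    if "k \<le> n" "a k \<le> v" "0 < c" "\<psi> (a k) \<le> ereal c" for k v c
  proof -
    have "ennreal (1 / c / u) \<le> g u" if "a k \<le> u" for u
      unfolding g_def using pos[OF \<open>k \<le> n\<close>] nonneg[of u] antimonoD[OF anti that] that \<open>\<psi> (a k) \<le> ereal c\<close> \<open>0 < c\<close>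
      by (intro inverse_profile_ge) (auto intro: order_trans)
    then have "(\<integral>\<^sup>+u. ennreal (1 / c / u) * indicator {a k..v} u \<partial>lborel) \<le> (\<integral>\<^sup>+u\<in>{a k..v}. g u \<partial>lborel)"
      by (intro nn_integral_mono) (auto simp: indicator_def)
    then show ?thesis
      by (subst (asm) nn_integral_inverse_Icc[OF pos[OF \<open>k \<le> n\<close>] that(2,3)])
  qed
  have degenerate: "(\<integral>\<^sup>+u\<in>{a k..b}. g u \<partial>lborel) = \<infinity>" if "k \<le> n" "a k < b" "\<psi> (a k) = 0" for k
  proof -
    have "ennreal (real m) \<le> (\<integral>\<^sup>+u\<in>{a k..b}. g u \<partial>lborel)" for m
    proof -
      have l: "ln (b / a k) > 0" using that pos[of k] by simp
      \<comment> \<open>Zero is below every positive \<open>c\<close>; this one makes the bound of the piece \<open>m + 1\<close>.\<close>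
      have "0 < ln (b / a k) / (real m + 1)" using l by simp
      from piece[OF \<open>k \<le> n\<close> less_imp_le[OF \<open>a k < b\<close>] this] that l
      have "ennreal (real m + 1) \<le> (\<integral>\<^sup>+u\<in>{a k..b}. g u \<partial>lborel)" by simp
      then show ?thesis by (rule order_trans[rotated]) (simp add: ennreal_leI)
    qed
    then show ?thesis
      by (metis ennreal_of_nat_eq_real_of_nat ennreal_Ex_less_of_nat infinity_ennreal_def less_top not_less)
  qed
  have lt_b: "a k < b" if "k \<le> n" for k
    using that
  proof (induction rule: inc_induct)
    case base
    then show ?case by (rule last)
  next
    case (step k)
    then show ?case using assms(5)[of k 0] nonneg by (simp add: zero_ereal_def[symmetric])
  qed
  \<comment> \<open>Pieces are collected from the right end, so that each step adds one piece on the left.\<close>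
  have "ennreal (real (n - k)) < (\<integral>\<^sup>+u\<in>{a k..b}. g u \<partial>lborel)" if "k \<le> n" for k
    using that
  proof (induction rule: inc_induct)
    case base
    obtain c where c: "\<psi> (a n) = ereal c" "0 \<le> c" using nonneg[of "a n"] fin[of n] by (cases "\<psi> (a n)") auto
    \<comment> \<open>The bound \<open>c + 1\<close> instead of \<open>c\<close> avoids division by zero.\<close>
    have "0 < ennreal (ln (b / a n) / (c + 1))" using c last pos[of n] by simp
    also have "\<dots> \<le> (\<integral>\<^sup>+u\<in>{a n..b}. g u \<partial>lborel)" using c last by (intro piece) auto
    finally show ?case by simp
  next
    case (step k)
    have kn: "k < n" using step by simp
    obtain c where c: "\<psi> (a k) = ereal c" "0 \<le> c" using nonneg[of "a k"] fin[of k] kn by (cases "\<psi> (a k)") auto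
    show ?case
    proof (cases "c = 0")
      case True
      then have "(\<integral>\<^sup>+u\<in>{a k..b}. g u \<partial>lborel) = \<infinity>"
        using degenerate[of k] lt_b[of k] c kn by (simp add: zero_ereal_def)
      then show ?thesis by (simp add: less_top[symmetric])
    next
      case False
      have ak: "0 < a k" using pos kn by simp
      have e: "a k * exp c \<le> a (Suc k)" using assms(5)[of k c] kn c by simp
      then have "exp c \<le> a (Suc k) / a k" using ak by (simp add: field_simps)
      then have l: "c \<le> ln (a (Suc k) / a k)" by (subst ln_ge_iff) (auto intro: less_le_trans[OF exp_gt_zero])
      have le: "a k \<le> a (Suc k)"
      proof -
        have "a k * 1 \<le> a k * exp c" using ak c by (intro mult_left_mono) auto
        with e show ?thesis by linarith
      qed
      have "ennreal 1 \<le> ennreal (ln (a (Suc k) / a k) / c)"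
        using l False c by (intro ennreal_leI) (simp add: field_simps)
      also have "\<dots> \<le> (\<integral>\<^sup>+u\<in>{a k..a (Suc k)}. g u \<partial>lborel)"
        using False c kn le by (intro piece) auto
      also have "\<dots> = (\<integral>\<^sup>+u\<in>{a k..<a (Suc k)}. g u \<partial>lborel)"
      proof (rule nn_integral_cong_AE, rule eventually_mono[OF AE_lborel_singleton[of "a (Suc k)"]])
        fix u assume "u \<noteq> a (Suc k)"
        then show "g u * indicator {a k..a (Suc k)} u = g u * indicator {a k..<a (Suc k)} u"
          by (auto simp: indicator_def less_le)
      qed
      finally have one: "1 \<le> (\<integral>\<^sup>+u\<in>{a k..<a (Suc k)}. g u \<partial>lborel)" by simp
      have "ennreal (real (n - k)) = 1 + ennreal (real (n - Suc k))"
        using kn by (simp add: of_nat_diff flip: ennreal_1 ennreal_plus)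
      also have "\<dots> < (\<integral>\<^sup>+u\<in>{a k..<a (Suc k)}. g u \<partial>lborel) + (\<integral>\<^sup>+u\<in>{a (Suc k)..b}. g u \<partial>lborel)"
      proof -
        have "1 + ennreal (real (n - Suc k)) < 1 + (\<integral>\<^sup>+u\<in>{a (Suc k)..b}. g u \<partial>lborel)"
          using step.IH by (simp add: ennreal_add_left_cancel_less)
        also have "\<dots> \<le> (\<integral>\<^sup>+u\<in>{a k..<a (Suc k)}. g u \<partial>lborel) + (\<integral>\<^sup>+u\<in>{a (Suc k)..b}. g u \<partial>lborel)"
          by (rule add_right_mono[OF one])
        finally show ?thesis .
      qed
      also have "\<dots> = (\<integral>\<^sup>+u\<in>{a k..b}. g u \<partial>lborel)"
        using le lt_b[of "Suc k"] kn
        by (subst nn_integral_add[symmetric]) (auto intro!: nn_integral_cong simp: indicator_def)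
      finally show ?thesis .
    qed
  qed
  from this[of 0] show ?thesis by (simp add: g_def)
qed

section \<open>Mixing from the root profile\<close>

context stationary_chain
begin

lemma antimono_root_profile: "antimono (root_profile p \<pi>)"
  unfolding root_profile_def by (intro antimonoI INF_superset_mono) auto

lemma root_profile_nonneg: "0 \<le> root_profile p \<pi> r"
  unfolding root_profile_def by (intro INF_greatest) (simp add: psi_set_nonneg)

text \<open>If no set had mass below the level at which the profile is evaluated, the contraction would
  hold with every coefficient. A coefficient above two would make the next mean gauge negative.\<close>
lemma root_profile_finite:
  assumes "mean_gauge n x > 0"
  shows "root_profile p \<pi> (4 / (mean_gauge n x)\<^sup>2) \<noteq> \<infinity>"
proof
  assume "root_profile p \<pi> (4 / (mean_gauge n x)\<^sup>2) = \<infinity>"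
  then have "mean_gauge (Suc n) x \<le> mean_gauge n x * (1 - 3 / 2)"
    using assms by (intro mean_gauge_Suc) auto
  then show False using mean_gauge_nonneg[of "Suc n" x] assms by simp
qed

text \<open>Were \<open>L\<^sub>n\<^sup>2\<close> still above \<open>\<epsilon>\<close>, the sequence \<open>a\<^sub>k = 4/L\<^sub>k\<^sup>2\<close> would stay below \<open>4/\<epsilon>\<close> for \<open>n\<close>
  steps and the integral would exceed \<open>n\<close>. Reversed endpoints are impossible in this situation,
  as \<open>4 \<pi>(x) \<le> a\<^sub>0 \<le> a\<^sub>n < 4/\<epsilon>\<close>.\<close>
lemma mean_gauge_sq_le:
  assumes "\<epsilon> > 0" "ereal (real n) \<ge>
      ext_integral (4 * pmf \<pi> x) (4 / \<epsilon>) (\<lambda>u. 1 / (ereal u * root_profile p \<pi> u))"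
  shows "(mean_gauge n x)\<^sup>2 \<le> \<epsilon>"
proof (rule ccontr)
  let ?\<psi> = "root_profile p \<pi>"
  define a where "a k = 4 / (mean_gauge k x)\<^sup>2" for k
  assume "\<not> (mean_gauge n x)\<^sup>2 \<le> \<epsilon>"
  then have big: "(mean_gauge n x)\<^sup>2 > \<epsilon>" by simp
  then have "mean_gauge n x \<noteq> 0" using assms(1) by auto
  then have posn: "mean_gauge n x > 0" using mean_gauge_nonneg[of n x] by simp
  have dec: "mean_gauge (Suc k) x \<le> mean_gauge k x" for k
    using mean_gauge_Suc_le[of 1 0 k x] root_profile_nonneg[of 1] by (simp add: zero_ereal_def[symmetric])
  have pos: "mean_gauge k x > 0" if "k \<le> n" for k
    using posn lift_Suc_antimono_le[of "\<lambda>k. mean_gauge k x", OF dec that] by linarith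
  have "ennreal (real n) < (\<integral>\<^sup>+u\<in>{a 0..4 / \<epsilon>}. e2ennreal (1 / (ereal u * ?\<psi> u)) \<partial>lborel)"
  proof (rule lt_nn_integral_inverse_profile[OF antimono_root_profile root_profile_nonneg])
    show "0 < a k" if "k \<le> n" for k using pos[OF that] by (simp add: a_def)
    show "?\<psi> (a k) \<noteq> \<infinity>" if "k \<le> n" for k
      unfolding a_def using pos[OF that] by (rule root_profile_finite)
    show "a n < 4 / \<epsilon>"
      unfolding a_def using big assms(1) posn by (intro divide_strict_left_mono) auto
    fix k c assume kc: "k < n" "0 \<le> c" "ereal c \<le> ?\<psi> (a k)"
    have pk: "mean_gauge k x > 0" "mean_gauge (Suc k) x > 0" using pos kc(1) by auto
    have "mean_gauge (Suc k) x \<le> mean_gauge k x * (1 - c / 2)"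
      using kc pk by (intro mean_gauge_Suc) (auto simp: a_def)
    also have "\<dots> \<le> mean_gauge k x * exp (- (c / 2))"
      using pk exp_ge_add_one_self[of "- (c / 2)"] by (intro mult_left_mono) auto
    finally have "(mean_gauge (Suc k) x)\<^sup>2 \<le> (mean_gauge k x * exp (- (c / 2)))\<^sup>2"
      using pk by (intro power_mono) auto
    also have "\<dots> = (mean_gauge k x)\<^sup>2 / exp c"
      by (simp add: power_mult_distrib exp_minus power_divide field_simps flip: exp_of_nat_mult exp_double)
    finally show "a k * exp c \<le> a (Suc k)"
      using pk unfolding a_def by (simp add: field_simps)
  qed
  also have "\<dots> \<le> (\<integral>\<^sup>+u\<in>{4 * pmf \<pi> x..4 / \<epsilon>}. e2ennreal (1 / (ereal u * ?\<psi> u)) \<partial>lborel)"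
  proof (intro nn_integral_mono mult_left_mono)
    have "4 * pmf \<pi> x \<le> a 0"
      using mean_gauge_0[of x] pos[of 0] pmf_pos[of x] by (simp add: a_def field_simps)
    then show "indicator {a 0..4 / \<epsilon>} u \<le> (indicator {4 * pmf \<pi> x..4 / \<epsilon>} u :: ennreal)" for u
      by (auto simp: indicator_def)
  qed simp
  finally have less: "ennreal (real n) < (\<integral>\<^sup>+u\<in>{4 * pmf \<pi> x..4 / \<epsilon>}. e2ennreal (1 / (ereal u * ?\<psi> u)) \<partial>lborel)" .
  have "4 * pmf \<pi> x \<le> 4 / \<epsilon>"
  proof (rule ccontr)
    assume "\<not> ?thesis"
    then have "{4 * pmf \<pi> x..4 / \<epsilon>} = {}" by auto
    then show False using less by simp
  qed
  then have "enn2ereal (\<integral>\<^sup>+u\<in>{4 * pmf \<pi> x..4 / \<epsilon>}. e2ennreal (1 / (ereal u * ?\<psi> u)) \<partial>lborel) \<le> enn2ereal (ennreal (real n))"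
    using assms(2) by (simp add: ext_integral_def)
  then have "(\<integral>\<^sup>+u\<in>{4 * pmf \<pi> x..4 / \<epsilon>}. e2ennreal (1 / (ereal u * ?\<psi> u)) \<partial>lborel) \<le> ennreal (real n)"
    unfolding less_eq_ennreal.rep_eq .
  then show False using less by (rule leD[THEN notE])
qed

end

theorem theorem4:
  fixes p :: "'a::countable \<Rightarrow> 'a pmf" and \<pi> :: "'a pmf"
    and x :: 'a and \<epsilon> :: real and n :: nat
  assumes "irreducible_chain p"
    and "stationary p \<pi>"
    and "\<epsilon> > 0"
    and "ereal (real n) \<ge>
           ext_integral (4 * pmf \<pi> x) (4 / \<epsilon>) (\<lambda>u. 1 / (ereal u * root_profile p \<pi> u))"
  shows "chi_square (nstep p n x) \<pi> \<le> ennreal \<epsilon>"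
proof -
  interpret stationary_chain p \<pi>
    by (rule irreducible_stationary_chain[OF assms(1,2)])
  have "chi_square (nstep p n x) \<pi> \<le> ennreal ((mean_gauge n x)\<^sup>2)"
    by (rule chi_square_le_mean_gauge)
  also have "\<dots> \<le> ennreal \<epsilon>"
    by (intro ennreal_leI mean_gauge_sq_le assms)
  finally show ?thesis .
qed

end
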